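(* Let $A\in\mathbb{R}^{n\times n}$ and $B\in\mathbb{R}^{n\times m}$ with $(A,B)$ controllable, let $Q\in\mathbb{R}^{n\times n}$ be symmetric with $Q\succeq 0$, let $R\in\mathbb{R}^{m\times m}$ be symmetric with $R\succ 0$, and let $\alpha_1\ge 0$, $\delta>0$, $\epsilon_1>0$, $\epsilon>0$. Let $\bar P\in\mathbb{R}^{n\times n}$ be a fixed matrix. Then the problem SDP-R-RE$\ell_1$-RLQ is a restriction of the problem RE$\ell_1$-RLQ (both defined in the context): the two problems minimize the same objective function $\mathbf{Tr}(X)+\alpha_1\|K\|_{\ell_1}$ over the variables $(X,K,F,P,Y)$, and every feasible point of SDP-R-RE$\ell_1$-RLQ is a feasible point of RE$\ell_1$-RLQ.
   Context: $\mathbb{S}^n_{++}$ and $\mathbb{S}^n_{+}$ denote the sets of symmetric positive definite and symmetric positive semidefinite real $n\times n$ matrices; $\succeq,\preceq,\succ$ denote the Loewner order on symmetric matrices. $\mathbf{Tr}$ is the trace, and $\|K\|_{\ell_1}$ is the sum of the absolute values of the entries of $K$. $\|U\|_*=\mathbf{Tr}(\sqrt{U^TU})$ is the nuclear norm of $U$ (the sum of its singular values). In both problems the variables are $X\in\mathbb{S}^n_{++}$, $Y\in\mathbb{S}^n_{+}$, $F\in\mathbb{S}^n_{+}$, $K\in\mathbb{R}^{m\times n}$, $P\in\mathbb{R}^{n\times n}$. The common constraints are: (i) $\begin{bmatrix} -Q-F+Y & 2X-P^T & P^T\\ 2X-P & I & 0\\ P & 0 & \frac{1}{\delta} I\end{bmatrix}\succeq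 0$; (ii) $P = X-\frac{A+BK}{2}$; (iii) $X\succeq \epsilon_1 I$; (iv) $\begin{bmatrix} Y & P^T\\ P & \frac{1}{1+\delta} I\end{bmatrix}\succeq 0$; (v) $\begin{bmatrix} F & K^T\\ K & R^{-1}\end{bmatrix}\succeq 0$. Problem RE$\ell_1$-RLQ: minimize $\mathbf{Tr}(X)+\alpha_1\|K\|_{\ell_1}$ over $(X,K,F,P,Y)$ subject to (i)–(v) and $\|Y-(1+\delta)P^TP\|_*\le \epsilon$. Given the fixed matrix $\bar P$ (an estimate of $P$), the affine approximation of $(1+\delta)P^TP$ at $\bar P$ is $$N=(1+\delta)\big(P^T\bar P+\bar P^T(P-\bar P)\big),$$ which is a function of the variable $P$. Problem SDP-R-RE$\ell_1$-RLQ: minimize $\mathbf{Tr}(X)+\alpha_1\|K\|_{\ell_1}$ over $(X,K,F,P,Y)$ subject to (i)–(v) and $$\begin{bmatrix} \frac{\epsilon}{n} I & Y-N\\ Y-N & \frac{\epsilon}{n} I\end{bmatrix}\succeq 0.$$ *)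

theory Defs
  imports "HOL-Analysis.Analysis"
begin

text \<open>An \<open>m \<times> n\<close> real matrix has type \<^typ>\<open>real ^ 'n ^ 'm\<close> (rows indexed by \<open>'m\<close>).\<close>

definition psd :: "real ^ 'n ^ 'n \<Rightarrow> bool" where
  "psd M \<longleftrightarrow> transpose M = M \<and> (\<forall>x. 0 \<le> x \<bullet> (M *v x))"

definition pd :: "real ^ 'n ^ 'n \<Rightarrow> bool" where
  "pd M \<longleftrightarrow> transpose M = M \<and> (\<forall>x. x \<noteq> 0 \<longrightarrow> 0 < x \<bullet> (M *v x))"

definition loewner_le :: "real ^ 'n ^ 'n \<Rightarrow> real ^ 'n ^ 'n \<Rightarrow> bool"  (infix \<open>\<preceq>\<^sub>L\<close> 50) where
  "M \<preceq>\<^sub>L N \<longleftrightarrow> psd (N - M)"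

text \<open>Block matrices are indexed by sum types; the arguments are listed row by row.\<close>

definition block_mat2 ::
  "real ^ 'a ^ 'a \<Rightarrow> real ^ 'b ^ 'a \<Rightarrow>
   real ^ 'a ^ 'b \<Rightarrow> real ^ 'b ^ 'b \<Rightarrow> real ^ ('a + 'b) ^ ('a + 'b)" where
  "block_mat2 M11 M12 M21 M22 = (\<chi> i j.
     case i of
       Inl i' \<Rightarrow> (case j of Inl j' \<Rightarrow> M11 $ i' $ j' | Inr j' \<Rightarrow> M12 $ i' $ j')
     | Inr i' \<Rightarrow> (case j of Inl j' \<Rightarrow> M21 $ i' $ j' | Inr j' \<Rightarrow> M22 $ i' $ j'))"

definition block_mat3 ::
  "real ^ 'a ^ 'a \<Rightarrow> real ^ 'b ^ 'a \<Rightarrow> real ^ 'c ^ 'a \<Rightarrow>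
   real ^ 'a ^ 'b \<Rightarrow> real ^ 'b ^ 'b \<Rightarrow> real ^ 'c ^ 'b \<Rightarrow>
   real ^ 'a ^ 'c \<Rightarrow> real ^ 'b ^ 'c \<Rightarrow> real ^ 'c ^ 'c \<Rightarrow>
   real ^ ('a + 'b + 'c) ^ ('a + 'b + 'c)" where
  "block_mat3 M11 M12 M13 M21 M22 M23 M31 M32 M33 = (\<chi> i j.
     case i of
       Inl i' \<Rightarrow> (case j of Inl j' \<Rightarrow> M11 $ i' $ j'
                         | Inr (Inl j') \<Rightarrow> M12 $ i' $ j' | Inr (Inr j') \<Rightarrow> M13 $ i' $ j')
     | Inr (Inl i') \<Rightarrow> (case j of Inl j' \<Rightarrow> M21 $ i' $ j'
                         | Inr (Inl j') \<Rightarrow> M22 $ i' $ j' | Inr (Inr j') \<Rightarrow> M23 $ i' $ j')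
     | Inr (Inr i') \<Rightarrow> (case j of Inl j' \<Rightarrow> M31 $ i' $ j'
                         | Inr (Inl j') \<Rightarrow> M32 $ i' $ j' | Inr (Inr j') \<Rightarrow> M33 $ i' $ j'))"

text \<open>The principal square root: a positive semidefinite matrix has exactly one positive
  semidefinite square root. The value is unspecified on other matrices.\<close>

definition matrix_sqrt :: "real ^ 'n ^ 'n \<Rightarrow> real ^ 'n ^ 'n" where
  "matrix_sqrt M = (THE S. psd S \<and> S ** S = M)"

definition nuclear_norm :: "real ^ 'n ^ 'm \<Rightarrow> real" where
  "nuclear_norm U = trace (matrix_sqrt (transpose U ** U))"

definition l1_norm :: "real ^ 'n ^ 'm \<Rightarrow> real" where
  "l1_norm K = (\<Sum>i\<in>UNIV. \<Sum>j\<in>UNIV. \<bar>K $ i $ j\<bar>)"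

text \<open>Controllability of \<open>x' = A x + B u\<close>: every state can be steered to every other state in any
  positive time. For such linear time-invariant systems, enlarging the class of inputs from
  continuous to piecewise continuous ones, or asking for some positive time only, defines the same
  pairs \<open>(A, B)\<close>.\<close>

definition controllable :: "real ^ 'n ^ 'n \<Rightarrow> real ^ 'm ^ 'n \<Rightarrow> bool" where
  "controllable A B \<longleftrightarrow>
     (\<forall>x0 x1. \<forall>T>0. \<exists>(u :: real \<Rightarrow> real ^ 'm) (x :: real \<Rightarrow> real ^ 'n).
        continuous_on {0..T} u \<and> x 0 = x0 \<and> x T = x1 \<and>
        (\<forall>t\<in>{0..T}. (x has_vector_derivative (A *v x t + B *v u t)) (at t within {0..T})))"

record 'v min_problem =
  objective :: "'v \<Rightarrow> real"
  feasible :: "'v set"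

definition restriction_of :: "'v min_problem \<Rightarrow> 'v min_problem \<Rightarrow> bool" where
  "restriction_of p q \<longleftrightarrow> objective p = objective q \<and> feasible p \<subseteq> feasible q"

text \<open>The decision variables are the tuples \<open>(X, K, F, P, Y)\<close>.\<close>

type_synonym ('n, 'm) rlq_vars =
  "(real ^ 'n ^ 'n) \<times> (real ^ 'n ^ 'm) \<times> (real ^ 'n ^ 'n) \<times> (real ^ 'n ^ 'n) \<times> (real ^ 'n ^ 'n)"

definition rlq_objective :: "real \<Rightarrow> ('n::finite, 'm::finite) rlq_vars \<Rightarrow> real" where
  "rlq_objective \<alpha>\<^sub>1 = (\<lambda>(X, K, F, P, Y). trace X + \<alpha>\<^sub>1 * l1_norm K)"

definition common_constraints ::
  "real ^ 'n ^ 'n \<Rightarrow> real ^ 'm ^ 'n \<Rightarrow> real ^ 'n ^ 'n \<Rightarrow> real ^ 'm ^ 'm \<Rightarrow> real \<Rightarrow> real \<Rightarrow>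
   ('n::finite, 'm::finite) rlq_vars set" where
  "common_constraints A B Q R \<delta> \<epsilon>\<^sub>1 = {(X, K, F, P, Y).
     pd X \<and> psd Y \<and> psd F \<and>
     0 \<preceq>\<^sub>L block_mat3
       (- Q - F + Y)             (2 *\<^sub>R X - transpose P)  (transpose P)
       (2 *\<^sub>R X - P)              (mat 1)                (0 :: real ^ 'n ^ 'n)
       P                         (0 :: real ^ 'n ^ 'n)  ((1 / \<delta>) *\<^sub>R mat 1) \<and>
     P = X - (1 / 2) *\<^sub>R (A + B ** K) \<and>
     \<epsilon>\<^sub>1 *\<^sub>R mat 1 \<preceq>\<^sub>L X \<and>
     0 \<preceq>\<^sub>L block_mat2 Y (transpose P) P ((1 / (1 + \<delta>)) *\<^sub>R mat 1) \<and>
     0 \<preceq>\<^sub>L block_mat2 F (transpose K) K (matrix_inv R)}"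

definition RE_l1_RLQ ::
  "real ^ 'n ^ 'n \<Rightarrow> real ^ 'm ^ 'n \<Rightarrow> real ^ 'n ^ 'n \<Rightarrow> real ^ 'm ^ 'm \<Rightarrow>
   real \<Rightarrow> real \<Rightarrow> real \<Rightarrow> real \<Rightarrow> ('n::finite, 'm::finite) rlq_vars min_problem" where
  "RE_l1_RLQ A B Q R \<alpha>\<^sub>1 \<delta> \<epsilon>\<^sub>1 \<epsilon> =
     \<lparr> objective = rlq_objective \<alpha>\<^sub>1,
       feasible = common_constraints A B Q R \<delta> \<epsilon>\<^sub>1 \<inter>
         {(X, K, F, P, Y). nuclear_norm (Y - (1 + \<delta>) *\<^sub>R (transpose P ** P)) \<le> \<epsilon>} \<rparr>"

definition affine_approx :: "real \<Rightarrow> real ^ 'n ^ 'n \<Rightarrow> real ^ 'n ^ 'n \<Rightarrow> real ^ 'n ^ 'n" where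
  "affine_approx \<delta> Pbar P =
     (1 + \<delta>) *\<^sub>R (transpose P ** Pbar + transpose Pbar ** (P - Pbar))"

definition SDP_R_RE_l1_RLQ ::
  "real ^ 'n ^ 'n \<Rightarrow> real ^ 'm ^ 'n \<Rightarrow> real ^ 'n ^ 'n \<Rightarrow> real ^ 'm ^ 'm \<Rightarrow>
   real \<Rightarrow> real \<Rightarrow> real \<Rightarrow> real \<Rightarrow> real ^ 'n ^ 'n \<Rightarrow>
   ('n::finite, 'm::finite) rlq_vars min_problem" where
  "SDP_R_RE_l1_RLQ A B Q R \<alpha>\<^sub>1 \<delta> \<epsilon>\<^sub>1 \<epsilon> Pbar =
     \<lparr> objective = rlq_objective \<alpha>\<^sub>1,
       feasible = common_constraints A B Q R \<delta> \<epsilon>\<^sub>1 \<inter>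
         {(X, K, F, P, Y).
            0 \<preceq>\<^sub>L block_mat2
              ((\<epsilon> / real CARD('n)) *\<^sub>R mat 1)  (Y - affine_approx \<delta> Pbar P)
              (Y - affine_approx \<delta> Pbar P)      ((\<epsilon> / real CARD('n)) *\<^sub>R mat 1)} \<rparr>"

end

theory Submission
  imports Defs
begin

text \<open>The block constraint (iv) gives \<open>E = Y - (1 + \<delta>) P\<^sup>T P \<succeq> 0\<close>, so that \<open>\<sqrt>(E\<^sup>T E) = E\<close> and the
  nuclear norm of \<open>E\<close> is its trace. Since \<open>(P - Pbar)\<^sup>T (P - Pbar) \<succeq> 0\<close>, the affine approximation
  \<open>N\<close> satisfies \<open>N \<preceq> (1 + \<delta>) P\<^sup>T P\<close>, hence \<open>E \<preceq> Y - N\<close>. The last block constraint, tested on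
  \<open>(x, -x)\<close>, gives \<open>Y - N \<preceq> (\<epsilon> / n) I\<close>, and so \<open>trace E \<le> \<epsilon>\<close>.\<close>

lemma matrix_add_distrib_right:
  fixes M N :: "real ^ 'b ^ 'a"
  shows "(M + N) ** L = M ** L + N ** L"
  by (simp add: matrix_matrix_mult_def vec_eq_iff distrib_right sum.distrib)

lemma matrix_diff_distrib_left:
  fixes M N :: "real ^ 'b ^ 'a"
  shows "L ** (M - N) = L ** M - L ** N"
  by (simp add: matrix_matrix_mult_def vec_eq_iff right_diff_distrib sum_subtractf)

lemma matrix_diff_distrib_right:
  fixes M N :: "real ^ 'b ^ 'a"
  shows "(M - N) ** L = M ** L - N ** L"
  by (simp add: matrix_matrix_mult_def vec_eq_iff left_diff_distrib sum_subtractf)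

lemma inner_vector_matrix_mult:
  fixes M :: "real ^ 'a ^ 'b"
  shows "x \<bullet> (y v* M) = (M *v x) \<bullet> y"
  by (metis dot_lmul_matrix inner_commute)

lemma inner_symmetric_matrix_mult:
  fixes M :: "real ^ 'n ^ 'n"
  assumes "transpose M = M"
  shows "x \<bullet> (M *v y) = (M *v x) \<bullet> y"
  by (metis assms inner_vector_matrix_mult transpose_matrix_vector)

lemma inner_axis_matrix_vector_mult:
  fixes M :: "real ^ 'n ^ 'n"
  shows "axis i 1 \<bullet> (M *v axis i 1) = M $ i $ i"
  by (simp add: inner_axis_axis inner_commute[of "axis i 1"] inner_axis
      matrix_vector_mul_component)

text \<open>Diagonal entries are the values of the quadratic form at the unit vectors
  \<open>axis i 1\<close>.\<close>

lemma trace_le_of_quadratic_form_le: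
  fixes M :: "real ^ 'n ^ 'n"
  assumes "\<And>x. x \<bullet> (M *v x) \<le> c * (x \<bullet> x)"
  shows "trace M \<le> real CARD('n) * c"
proof -
  have "M $ i $ i \<le> c" for i
    using assms[of "axis i 1"] by (simp add: inner_axis_matrix_vector_mult inner_axis_axis)
  then have "trace M \<le> (\<Sum>i\<in>(UNIV :: 'n set). c)"
    unfolding trace_def by (intro sum_mono)
  then show ?thesis by simp
qed

text \<open>Along the line \<open>y + t z\<close> with \<open>z = S *v y\<close>, the form has no
  constant term, and its linear coefficient is twice the squared norm of \<open>z\<close>. It would
  turn negative for small negative \<open>t\<close> unless \<open>z = 0\<close>.\<close>

lemma psd_vector_mult_eq_0:
  assumes S: "psd S" and y: "y \<bullet> (S *v y) = 0"
  shows "S *v y = 0"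
proof (rule ccontr)
  assume nz: "S *v y \<noteq> 0"
  define z where "z = S *v y"
  define a where "a = z \<bullet> z"
  define q where "q = z \<bullet> (S *v z)"
  have sym: "y \<bullet> (S *v z) = a"
    using S inner_symmetric_matrix_mult[of S y z] by (simp add: psd_def a_def z_def)
  have a: "a > 0" using nz by (simp add: a_def z_def)
  have q: "q \<ge> 0" using S by (simp add: psd_def q_def)
  have "(y + t *\<^sub>R z) \<bullet> (S *v (y + t *\<^sub>R z)) = 2 * t * a + t\<^sup>2 * q" for t
    using y sym
    by (simp add: matrix_vector_right_distrib matrix_vector_mult_scaleR inner_add_left
        inner_add_right q_def a_def z_def[symmetric] power2_eq_square algebra_simps)
  then have nonneg: "0 \<le> 2 * t * a + t\<^sup>2 * q" for t
    using S by (metis psd_def)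
  \<comment> \<open>Any \<open>s > 0\<close> with \<open>s * q < 2 * a\<close> would do; the
    \<open>+ 1\<close> keeps the denominator positive when \<open>q = 0\<close>.\<close>
  define s where "s = a / (q + 1)"
  have s: "s > 0" "s * q \<le> a" using a q by (simp_all add: s_def field_simps)
  then have "0 < s * (2 * a - s * q)" using a by simp
  with nonneg[of "- s"] show False
    by (simp add: power2_eq_square algebra_simps)
qed

text \<open>Symmetry moves the left factor \<open>D\<close> onto the basis vector, so each diagonal
  entry is a value of the quadratic form of \<open>S\<close> at a column of
  \<open>D\<close>.\<close>

lemma trace_sandwich:
  fixes S D :: "real ^ 'n ^ 'n"
  assumes "transpose D = D"
  shows "trace (D ** S ** D) = (\<Sum>i\<in>UNIV. (D *v axis i 1) \<bullet> (S *v (D *v axis i 1)))"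
proof -
  have "(D ** S ** D) $ i $ i = (D *v axis i 1) \<bullet> (S *v (D *v axis i 1))" for i
    using assms inner_symmetric_matrix_mult[of D "axis i 1"]
    by (simp flip: inner_axis_matrix_vector_mult matrix_vector_mul_assoc)
  then show ?thesis by (simp add: trace_def)
qed

lemma psd_sandwich_trace_nonneg:
  assumes "psd S" "transpose D = D"
  shows "0 \<le> trace (D ** S ** D)"
  using assms by (auto simp: trace_sandwich psd_def intro!: sum_nonneg)

text \<open>A vanishing sum of nonnegative terms vanishes termwise, so \<open>S\<close> annihilates
  every column of \<open>D\<close>.\<close>

lemma psd_sandwich_trace_eq_0:
  assumes S: "psd S" and D: "transpose D = D" and tr: "trace (D ** S ** D) = 0"
  shows "S ** D = 0"
proof -
  have "\<forall>i\<in>UNIV. (D *v axis i 1) \<bullet> (S *v (D *v axis i 1)) = 0"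
    using tr S unfolding trace_sandwich[OF D]
    by (subst (asm) sum_nonneg_eq_0_iff) (auto simp: psd_def)
  then have "(S ** D) *v axis i 1 = 0" for i
    using psd_vector_mult_eq_0[OF S] by (simp flip: matrix_vector_mul_assoc)
  then have "column i (S ** D) = 0" for i
    by (simp add: matrix_vector_mult_basis)
  then show ?thesis
    by (simp add: column_def vec_eq_iff)
qed

text \<open>For \<open>D = S - E\<close>, equality of the squares says \<open>D (S + E) + (S + E) D = 0\<close>, so cyclicity of
  the trace makes the nonnegative numbers \<open>trace (D S D)\<close> and \<open>trace (D E D)\<close> sum to zero.\<close>

lemma psd_square_root_unique:
  assumes S: "psd S" and E: "psd E" and eq: "S ** S = E ** E"
  shows "S = E"
proof -
  define D where "D = S - E"
  have D: "transpose D = D"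
    using S E by (simp add: D_def psd_def transpose_def vec_eq_iff)
  have anti: "D ** (S + E) = - ((S + E) ** D)"
    using eq unfolding D_def
    by (simp add: matrix_add_ldistrib matrix_add_distrib_right matrix_diff_distrib_left matrix_diff_distrib_right)
  have "trace (D ** (S + E) ** D) = trace ((S + E) ** D ** D)"
    by (metis matrix_mul_assoc trace_mul_sym)
  also have "(S + E) ** D = - (D ** (S + E))"
    using anti by simp
  also have "trace (- (D ** (S + E)) ** D) = - trace (D ** (S + E) ** D)"
    by (simp add: trace_def matrix_matrix_mult_def sum_negf)
  finally have "trace (D ** S ** D) + trace (D ** E ** D) = 0"
    by (simp add: matrix_add_ldistrib matrix_add_distrib_right trace_add)
  then have "trace (D ** S ** D) = 0" "trace (D ** E ** D) = 0"
    using psd_sandwich_trace_nonneg[OF S D] psd_sandwich_trace_nonneg[OF E D] by linarith+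
  then have "S ** D = 0" "E ** D = 0"
    using psd_sandwich_trace_eq_0 S E D by blast+
  \<comment> \<open>Subtracting the two products gives a zero square; since \<open>D\<close> is
    symmetric, the squared norm of \<open>D *v x\<close> is the inner product of \<open>x\<close>
    with \<open>(D ** D) *v x\<close>.\<close>
  then have DD: "D ** D = 0"
    by (simp add: D_def matrix_diff_distrib_right)
  have "(D *v x) \<bullet> (D *v x) = 0" for x
    using D DD inner_symmetric_matrix_mult[of D x "D *v x"]
    by (simp add: matrix_vector_mul_assoc)
  then have "D *v x = 0 *v x" for x by simp
  then have "D = 0" using matrix_eq by blast
  then show ?thesis by (simp add: D_def)
qed

text \<open>By symmetry \<open>E\<close> is itself a psd root of \<open>transpose E ** E\<close>,
  and uniqueness of the root resolves the \<open>THE\<close> in \<open>matrix_sqrt\<close>.\<close>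

lemma nuclear_norm_psd:
  assumes "psd E"
  shows "nuclear_norm E = trace E"
proof -
  have "matrix_sqrt (transpose E ** E) = E"
    unfolding matrix_sqrt_def
    using assms psd_square_root_unique[OF _ assms]
    by (intro the_equality) (auto simp: psd_def)
  then show ?thesis by (simp add: nuclear_norm_def)
qed

lemma block_mat2_quadratic_form:
  fixes M11 :: "real ^ 'a ^ 'a" and M12 :: "real ^ 'b ^ 'a"
    and M21 :: "real ^ 'a ^ 'b" and M22 :: "real ^ 'b ^ 'b"
  assumes "0 \<preceq>\<^sub>L block_mat2 M11 M12 M21 M22"
  shows "0 \<le> x \<bullet> (M11 *v x) + x \<bullet> (M12 *v y) + y \<bullet> (M21 *v x) + y \<bullet> (M22 *v y)"
proof -
  define v :: "real ^ ('a + 'b)"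
    where "v = (\<chi> k. case k of Inl i \<Rightarrow> x $ i | Inr j \<Rightarrow> y $ j)"
  have sum_split: "(\<Sum>k\<in>UNIV. f k) = (\<Sum>i\<in>UNIV. f (Inl i)) + (\<Sum>j\<in>UNIV. f (Inr j))"
    for f :: "'a + 'b \<Rightarrow> real"
    by (simp add: sum.Plus flip: UNIV_Plus_UNIV)
  have "v \<bullet> (block_mat2 M11 M12 M21 M22 *v v) =
      x \<bullet> (M11 *v x) + x \<bullet> (M12 *v y) + y \<bullet> (M21 *v x) + y \<bullet> (M22 *v y)"
    by (simp add: v_def block_mat2_def inner_vec_def matrix_vector_mult_def sum_split
        sum.distrib distrib_left)
  moreover have "0 \<le> v \<bullet> (block_mat2 M11 M12 M21 M22 *v v)"
    using assms by (simp add: loewner_le_def psd_def)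
  ultimately show ?thesis by simp
qed

lemma schur_complement_psd:
  fixes Y P :: "real ^ 'n ^ 'n"
  assumes Y: "transpose Y = Y" and c: "c > 0"
    and block: "0 \<preceq>\<^sub>L block_mat2 Y (transpose P) P ((1 / c) *\<^sub>R mat 1)"
  shows "psd (Y - c *\<^sub>R (transpose P ** P))"
proof -
  have "transpose (transpose P ** P) = transpose P ** P"
    by (simp add: matrix_transpose_mul)
  then have sym: "transpose (Y - c *\<^sub>R (transpose P ** P)) = Y - c *\<^sub>R (transpose P ** P)"
    using Y by (simp add: transpose_def vec_eq_iff)
  \<comment> \<open>The second component \<open>- c *\<^sub>R (P *v x)\<close> minimizes the block
    form for fixed \<open>x\<close>; the minimum is the form of the Schur complement.\<close>
  have "0 \<le> x \<bullet> ((Y - c *\<^sub>R (transpose P ** P)) *v x)" for x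
    using c block_mat2_quadratic_form[OF block, of x "- c *\<^sub>R (P *v x)"]
    by (simp add: matrix_vector_mult_diff_rdistrib matrix_vector_mult_scaleR inner_diff_right
        inner_vector_matrix_mult scaleR_matrix_vector_assoc[symmetric] 
        matrix_vector_mul_assoc[symmetric])
  with sym show ?thesis by (simp add: psd_def)
qed

text \<open>For fixed \<open>x\<close>, the squared norm of \<open>P *v x\<close> is convex in
  \<open>P\<close> and lies above its tangent at \<open>Pbar\<close>; the gap is the squared norm of
  \<open>(P - Pbar) *v x\<close>.\<close>

lemma affine_approx_quadratic_form_le:
  assumes "0 \<le> 1 + \<delta>"
  shows "x \<bullet> (affine_approx \<delta> Pbar P *v x) \<le> (1 + \<delta>) * ((P *v x) \<bullet> (P *v x))"
proof -
  have "0 \<le> (P *v x - Pbar *v x) \<bullet> (P *v x - Pbar *v x)" by simp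
  then have "(P *v x) \<bullet> (Pbar *v x) + (Pbar *v x) \<bullet> (P *v x - Pbar *v x) \<le> (P *v x) \<bullet> (P *v x)"
    by (simp add: inner_diff_left inner_diff_right inner_commute)
  then have "(1 + \<delta>) * ((P *v x) \<bullet> (Pbar *v x) + (Pbar *v x) \<bullet> (P *v x - Pbar *v x))
      \<le> (1 + \<delta>) * ((P *v x) \<bullet> (P *v x))"
    using assms by (rule mult_left_mono)
  then show ?thesis
    by (simp add: affine_approx_def scaleR_matrix_vector_assoc[symmetric]
        matrix_vector_mult_add_rdistrib inner_add_right inner_vector_matrix_mult
        matrix_vector_mult_diff_rdistrib matrix_vector_mul_assoc[symmetric])
qed

lemma block_mat2_off_diagonal_le:
  assumes "0 \<preceq>\<^sub>L block_mat2 (c *\<^sub>R mat 1) M M (c *\<^sub>R mat 1)"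
  shows "x \<bullet> (M *v x) \<le> c * (x \<bullet> x)"
proof -
  have "M *v (- x) = - (M *v x)"
    by (simp add: vec_eq_iff matrix_vector_mult_def sum_negf)
  then show ?thesis
    using block_mat2_quadratic_form[OF assms, of x "- x"]
    by (simp add: scaleR_matrix_vector_assoc[symmetric])
qed

lemma nuclear_norm_affine_approx_le:
  fixes Y P Pbar :: "real ^ 'n ^ 'n"
  assumes \<delta>: "0 < 1 + \<delta>" and Y: "transpose Y = Y"
    and schur: "0 \<preceq>\<^sub>L block_mat2 Y (transpose P) P ((1 / (1 + \<delta>)) *\<^sub>R mat 1)"
    and approx: "0 \<preceq>\<^sub>L block_mat2
      ((\<epsilon> / real CARD('n)) *\<^sub>R mat 1)  (Y - affine_approx \<delta> Pbar P)
      (Y - affine_approx \<delta> Pbar P)      ((\<epsilon> / real CARD('n)) *\<^sub>R mat 1)"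
  shows "nuclear_norm (Y - (1 + \<delta>) *\<^sub>R (transpose P ** P)) \<le> \<epsilon>"
proof -
  let ?E = "Y - (1 + \<delta>) *\<^sub>R (transpose P ** P)"
  have "x \<bullet> (?E *v x) \<le> \<epsilon> / real CARD('n) * (x \<bullet> x)" for x
  proof -
    have "x \<bullet> (?E *v x) = x \<bullet> (Y *v x) - (1 + \<delta>) * ((P *v x) \<bullet> (P *v x))"
      by (simp add: matrix_vector_mult_diff_rdistrib inner_diff_right
          inner_vector_matrix_mult scaleR_matrix_vector_assoc[symmetric]
          matrix_vector_mul_assoc[symmetric])
    also have "\<dots> \<le> x \<bullet> ((Y - affine_approx \<delta> Pbar P) *v x)"
      using affine_approx_quadratic_form_le[of \<delta> x Pbar P] \<delta>
      by (simp add: matrix_vector_mult_diff_rdistrib inner_diff_right)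
    also have "\<dots> \<le> \<epsilon> / real CARD('n) * (x \<bullet> x)"
      by (rule block_mat2_off_diagonal_le[OF approx])
    finally show ?thesis .
  qed
  \<comment> \<open>The dimension factor of the trace bound cancels the scaling of the diagonal
    blocks.\<close>
  then have "trace ?E \<le> real CARD('n) * (\<epsilon> / real CARD('n))"
    by (rule trace_le_of_quadratic_form_le)
  then show ?thesis
    using nuclear_norm_psd[OF schur_complement_psd[OF Y \<delta> schur]] by simp
qed

theorem proposition2:
  fixes A :: "real ^ 'n ^ 'n" and B :: "real ^ 'm ^ 'n"
    and Q :: "real ^ 'n ^ 'n" and R :: "real ^ 'm ^ 'm"
    and Pbar :: "real ^ 'n ^ 'n"
    and \<alpha>\<^sub>1 \<delta> \<epsilon>\<^sub>1 \<epsilon> :: real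
  assumes "controllable A B"
    and "psd Q" and "pd R"
    and "0 \<le> \<alpha>\<^sub>1" and "0 < \<delta>" and "0 < \<epsilon>\<^sub>1" and "0 < \<epsilon>"
  shows "restriction_of (SDP_R_RE_l1_RLQ A B Q R \<alpha>\<^sub>1 \<delta> \<epsilon>\<^sub>1 \<epsilon> Pbar)
                        (RE_l1_RLQ A B Q R \<alpha>\<^sub>1 \<delta> \<epsilon>\<^sub>1 \<epsilon>)"
proof -
  have "0 < 1 + \<delta>" using assms by simp
  \<comment> \<open>Objective and common constraints coincide, so only the nuclear norm bound
    remains; \<open>psd Y\<close> supplies the symmetry of \<open>Y\<close>.\<close>
  then show ?thesis
    unfolding restriction_of_def SDP_R_RE_l1_RLQ_def RE_l1_RLQ_def common_constraints_def
    by (auto simp: psd_def intro: nuclear_norm_affine_approx_le)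
qed

end
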